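(* Let $\mathcal{G}=(V,E)$ be a directed mixed graph (DMG), let $\mathcal{I}(\mathcal{G})$ be its $\mu$-separation independence model, and let $[\mathcal{G}]$ be its Markov equivalence class. Let $\mathcal{N}=\mathcal{N}(\mathcal{I}(\mathcal{G}))$ be the DMG with node set $V$ in which, for all $\alpha,\beta\in V$, the directed edge $\alpha\rightarrow\beta$ is present if and only if $\alpha$ is a potential parent of $\beta$ in $\mathcal{I}(\mathcal{G})$, and the bidirected edge $\alpha\leftrightarrow\beta$ is present if and only if $\alpha$ and $\beta$ are potential siblings in $\mathcal{I}(\mathcal{G})$. Then $\mathcal{N}\in[\mathcal{G}]$ and $\mathcal{N}$ is a supergraph of all elements of $[\mathcal{G}]$. Furthermore, if $\mathcal{G}_0,\mathcal{G}_1,\ldots,\mathcal{G}_m$ is a finite sequence of DMGs, $\mathcal{G}_i=(V,E_i)$, such that $\mathcal{G}_0=\mathcal{G}$, $\mathcal{G}_m=\mathcal{N}$, and $E_i\subseteq E_{i+1}$ for all $i=0,\ldots,m-1$, then $\mathcal{G}_i$ is Markov equivalent with $\mathcal{N}$ for all $i=0,\ldots,m-1$.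
   Context: A directed mixed graph (DMG) $\mathcal{G}=(V,E)$ has a finite node set $V$ and an edge set $E=E_d\sqcup E_b$, where $E_d$ is a set of ordered pairs of nodes (directed edges $\alpha\rightarrow\beta$, with $\alpha=\beta$ allowed) and $E_b$ is a set of unordered pairs (bidirected edges $\alpha\leftrightarrow\beta$, with $\alpha=\beta$ allowed). Several edges may be present between the same two nodes. The edge $\alpha\rightarrow\beta$ has a tail at $\alpha$ and a head at $\beta$; $\alpha\leftrightarrow\beta$ has heads at both ends. $(V,E_2)$ is a supergraph of $(V,E_1)$ if $E_1\subseteq E_2$. A walk is a sequence $\langle\gamma_1,e_1,\gamma_2,\ldots,e_n,\gamma_{n+1}\rangle$ with $e_i$ an edge between $\gamma_i$ and $\gamma_{i+1}$, together with an orientation of each directed loop on it (pointing towards $\gamma_1$ or towards $\gamma_{n+1}$); nodes and edges may repeat. It is nontrivial if $n\ge 1$. A non-endpoint occurrence $\gamma_i$ ($1<i<n+1$) is a collider if $e_{i-1}$ and $e_i$ both have heads at that occurrence, and otherwise a noncollider; endpoints are neither. For $C\subseteq V$, $An(C)$ is the set of nodes from which there is a directed path $\gamma\rightarrow\cdots\rightarrow c$ (possibly of length zero) to some $c\in C$; thus $C\subseteq An(C)$. A nontrivial walk from $\alpha$ to $\beta$ is $\mu$-connecting given $C$ if $\alpha\notin C$, every collider is in $An(C)$, no noncollider is in $C$, and the last edge has a head at (the final) $\beta$. For $A,B,C\subseteq V$ (not necessarily disjoint), $B$ is $\mu$-separated from $A$ given $C$ if there is no $\mu$-connecting walk from any $\alpha\in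 A$ to any $\beta\in B$ given $C$. $\mathcal{I}(\mathcal{G})$ is the set of triples $\langle A,B\mid C\rangle$ of subsets of $V$ such that $B$ is $\mu$-separated from $A$ given $C$ in $\mathcal{G}$. DMGs $\mathcal{G}_1,\mathcal{G}_2$ on the same node set are Markov equivalent if $\mathcal{I}(\mathcal{G}_1)=\mathcal{I}(\mathcal{G}_2)$; $[\mathcal{G}]$ is the equivalence class of $\mathcal{G}$. Let $\mathcal{I}$ be an independence model over $V$, i.e. a set of triples $\langle A,B\mid C\rangle$ with $A,B,C\subseteq V$ (singletons are written as their element). $\beta$ is separable from $\alpha$ if there is $C\subseteq V\setminus\{\alpha\}$ with $\langle\alpha,\beta\mid C\rangle\in\mathcal{I}$; $u(\beta,\mathcal{I})$ is the set of $\gamma\in V$ such that $\beta$ is not separable from $\gamma$. $\alpha$ and $\beta$ are potential siblings in $\mathcal{I}$ if: (s1) $\beta\in u(\alpha,\mathcal{I})$ and $\alpha\in u(\beta,\mathcal{I})$; (s2) for all $\gamma\in V$, $C\subseteq V$ with $\beta\in C$: $\langle\gamma,\alpha\mid C\rangle\in\mathcal{I}\Rightarrow\langle\gamma,\beta\mid C\rangle\in\mathcal{I}$; (s3) for all $\gamma\in V$, $C\subseteq V$ with $\alpha\in C$: $\langle\gamma,\beta\mid C\rangle\in\mathcal{I}\Rightarrow\langle\gamma,\alpha\mid C\rangle\in\mathcal{I}$. $\alpha$ is a potential parent of $\beta$ in $\mathcal{I}$ if: (p1) $\alpha\in u(\beta,\mathcal{I})$; (p2) for all $\gamma\in V$,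 $C\subseteq V$ with $\alpha\notin C$: $\langle\gamma,\beta\mid C\rangle\in\mathcal{I}\Rightarrow\langle\gamma,\alpha\mid C\rangle\in\mathcal{I}$; (p3) for all $\gamma,\delta\in V$, $C\subseteq V$ with $\alpha\notin C$, $\beta\in C$: $\langle\gamma,\delta\mid C\rangle\in\mathcal{I}\Rightarrow\langle\gamma,\beta\mid C\rangle\in\mathcal{I}$ or $\langle\alpha,\delta\mid C\rangle\in\mathcal{I}$; (p4) for all $\gamma\in V$, $C\subseteq V$ with $\alpha\notin C$: $\langle\beta,\gamma\mid C\rangle\in\mathcal{I}\Rightarrow\langle\beta,\gamma\mid C\cup\{\alpha\}\rangle\in\mathcal{I}$. *)

theory Defs
  imports "HOL-Library.Uprod"
begin

section \<open>Directed mixed graphs\<close>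

datatype 'a edge = Directed 'a 'a | Bidirected "'a uprod"

record 'a dmg =
  verts :: "'a set"
  edges :: "'a edge set"

fun ends :: "'a edge \<Rightarrow> 'a set" where
  "ends (Directed a b) = {a, b}"
| "ends (Bidirected p) = set_uprod p"

definition is_dmg :: "'a dmg \<Rightarrow> bool" where
  "is_dmg G \<longleftrightarrow> finite (verts G) \<and> (\<forall>e\<in>edges G. ends e \<subseteq> verts G)"

definition supergraph :: "'a dmg \<Rightarrow> 'a dmg \<Rightarrow> bool" where
  "supergraph H G \<longleftrightarrow> verts H = verts G \<and> edges G \<subseteq> edges H"

section \<open>Walks\<close>

text \<open>
  A walk \<open>\<langle>\<gamma>\<^sub>1, e\<^sub>1, \<gamma>\<^sub>2, \<dots>, e\<^sub>n, \<gamma>\<^sub>n\<^sub>+\<^sub>1\<rangle>\<close> is given by the list of its nodes and, for each step, a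
  mark: \<open>Along\<close> for \<open>\<gamma>\<^sub>i \<rightarrow> \<gamma>\<^sub>i\<^sub>+\<^sub>1\<close>, \<open>Against\<close> for \<open>\<gamma>\<^sub>i \<leftarrow> \<gamma>\<^sub>i\<^sub>+\<^sub>1\<close>, \<open>Both\<close> for \<open>\<gamma>\<^sub>i \<leftrightarrow> \<gamma>\<^sub>i\<^sub>+\<^sub>1\<close>.
  The two nodes and the mark determine the edge. Conversely, the edge and its two nodes determine the
  mark, except for a directed loop, where the choice between \<open>Along\<close> and \<open>Against\<close> is the orientation
  of the loop that is part of the walk.
  With zero-based indices, step \<open>i\<close> leads from node \<open>i\<close> to node \<open>Suc i\<close>.
\<close>

datatype mark = Along | Against | Both

fun step_edge :: "'a \<Rightarrow> mark \<Rightarrow> 'a \<Rightarrow> 'a edge" where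
  "step_edge a Along b = Directed a b"
| "step_edge a Against b = Directed b a"
| "step_edge a Both b = Bidirected (Upair a b)"

definition head_at_start :: "mark \<Rightarrow> bool" where
  "head_at_start m \<longleftrightarrow> m = Against \<or> m = Both"

definition head_at_end :: "mark \<Rightarrow> bool" where
  "head_at_end m \<longleftrightarrow> m = Along \<or> m = Both"

definition is_walk :: "'a dmg \<Rightarrow> 'a list \<Rightarrow> mark list \<Rightarrow> bool" where
  "is_walk G ns ms \<longleftrightarrow>
     length ns = Suc (length ms) \<and> set ns \<subseteq> verts G \<and>
     (\<forall>i<length ms. step_edge (ns ! i) (ms ! i) (ns ! Suc i) \<in> edges G)"

text \<open>Colliders and noncolliders are positions (occurrences of nodes) on a walk.\<close>

definition collider :: "mark list \<Rightarrow> nat \<Rightarrow> bool" where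
  "collider ms i \<longleftrightarrow>
     0 < i \<and> i < length ms \<and> head_at_end (ms ! (i - 1)) \<and> head_at_start (ms ! i)"

definition noncollider :: "mark list \<Rightarrow> nat \<Rightarrow> bool" where
  "noncollider ms i \<longleftrightarrow> 0 < i \<and> i < length ms \<and> \<not> collider ms i"

definition An :: "'a dmg \<Rightarrow> 'a set \<Rightarrow> 'a set" where
  "An G C = {a. \<exists>c\<in>C. (a, c) \<in> {(x, y). Directed x y \<in> edges G}\<^sup>*}"

section \<open>\<open>\<mu>\<close>-separation and Markov equivalence\<close>

definition mu_connecting :: "'a dmg \<Rightarrow> 'a set \<Rightarrow> 'a list \<Rightarrow> mark list \<Rightarrow> bool" where
  "mu_connecting G C ns ms \<longleftrightarrow>
     is_walk G ns ms \<and> ms \<noteq> [] \<and> hd ns \<notin> C \<and>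
     (\<forall>i. collider ms i \<longrightarrow> ns ! i \<in> An G C) \<and>
     (\<forall>i. noncollider ms i \<longrightarrow> ns ! i \<notin> C) \<and>
     head_at_end (last ms)"

definition mu_separated :: "'a dmg \<Rightarrow> 'a set \<Rightarrow> 'a set \<Rightarrow> 'a set \<Rightarrow> bool" where
  "mu_separated G A B C \<longleftrightarrow>
     \<not> (\<exists>a\<in>A. \<exists>b\<in>B. \<exists>ns ms. hd ns = a \<and> last ns = b \<and> mu_connecting G C ns ms)"

text \<open>A triple \<open>(A, B, C)\<close> stands for \<open>\<langle>A, B | C\<rangle>\<close>: \<open>B\<close> is independent of \<open>A\<close> given \<open>C\<close>.\<close>

type_synonym 'a indep_model = "('a set \<times> 'a set \<times> 'a set) set"

definition indep_model :: "'a dmg \<Rightarrow> 'a indep_model" where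
  "indep_model G =
     {(A, B, C). A \<subseteq> verts G \<and> B \<subseteq> verts G \<and> C \<subseteq> verts G \<and> mu_separated G A B C}"

definition markov_equivalent :: "'a dmg \<Rightarrow> 'a dmg \<Rightarrow> bool" where
  "markov_equivalent G H \<longleftrightarrow> verts G = verts H \<and> indep_model G = indep_model H"

definition markov_class :: "'a dmg \<Rightarrow> 'a dmg set" where
  "markov_class G = {H. is_dmg H \<and> markov_equivalent H G}"

section \<open>Potential siblings and potential parents\<close>

definition separable :: "'a set \<Rightarrow> 'a indep_model \<Rightarrow> 'a \<Rightarrow> 'a \<Rightarrow> bool" where
  \<comment> \<open>\<open>\<beta>\<close> is separable from \<open>\<alpha>\<close>\<close>
  "separable V I \<beta> \<alpha> \<longleftrightarrow> (\<exists>C \<subseteq> V - {\<alpha>}. ({\<alpha>}, {\<beta>}, C) \<in> I)"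

definition u :: "'a set \<Rightarrow> 'a indep_model \<Rightarrow> 'a \<Rightarrow> 'a set" where
  "u V I \<beta> = {\<gamma> \<in> V. \<not> separable V I \<beta> \<gamma>}"

definition potential_siblings :: "'a set \<Rightarrow> 'a indep_model \<Rightarrow> 'a \<Rightarrow> 'a \<Rightarrow> bool" where
  "potential_siblings V I \<alpha> \<beta> \<longleftrightarrow>
     \<beta> \<in> u V I \<alpha> \<and> \<alpha> \<in> u V I \<beta> \<and>
     (\<forall>\<gamma>\<in>V. \<forall>C\<subseteq>V. \<beta> \<in> C \<longrightarrow> ({\<gamma>}, {\<alpha>}, C) \<in> I \<longrightarrow> ({\<gamma>}, {\<beta>}, C) \<in> I) \<and>
     (\<forall>\<gamma>\<in>V. \<forall>C\<subseteq>V. \<alpha> \<in> C \<longrightarrow> ({\<gamma>}, {\<beta>}, C) \<in> I \<longrightarrow> ({\<gamma>}, {\<alpha>}, C) \<in> I)"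

definition potential_parent :: "'a set \<Rightarrow> 'a indep_model \<Rightarrow> 'a \<Rightarrow> 'a \<Rightarrow> bool" where
  \<comment> \<open>\<open>\<alpha>\<close> is a potential parent of \<open>\<beta>\<close>\<close>
  "potential_parent V I \<alpha> \<beta> \<longleftrightarrow>
     \<alpha> \<in> u V I \<beta> \<and>
     (\<forall>\<gamma>\<in>V. \<forall>C\<subseteq>V. \<alpha> \<notin> C \<longrightarrow> ({\<gamma>}, {\<beta>}, C) \<in> I \<longrightarrow> ({\<gamma>}, {\<alpha>}, C) \<in> I) \<and>
     (\<forall>\<gamma>\<in>V. \<forall>\<delta>\<in>V. \<forall>C\<subseteq>V. \<alpha> \<notin> C \<longrightarrow> \<beta> \<in> C \<longrightarrow>
        ({\<gamma>}, {\<delta>}, C) \<in> I \<longrightarrow> ({\<gamma>}, {\<beta>}, C) \<in> I \<or> ({\<alpha>}, {\<delta>}, C) \<in> I) \<and>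
     (\<forall>\<gamma>\<in>V. \<forall>C\<subseteq>V. \<alpha> \<notin> C \<longrightarrow> ({\<beta>}, {\<gamma>}, C) \<in> I \<longrightarrow> ({\<beta>}, {\<gamma>}, C \<union> {\<alpha>}) \<in> I)"

definition potential_graph :: "'a set \<Rightarrow> 'a indep_model \<Rightarrow> 'a dmg" where
  "potential_graph V I =
     \<lparr>verts = V,
      edges = {Directed \<alpha> \<beta> |\<alpha> \<beta>. \<alpha> \<in> V \<and> \<beta> \<in> V \<and> potential_parent V I \<alpha> \<beta>} \<union>
              {Bidirected (Upair \<alpha> \<beta>) |\<alpha> \<beta>. \<alpha> \<in> V \<and> \<beta> \<in> V \<and> potential_siblings V I \<alpha> \<beta>}\<rparr>"

lemma potential_siblings_sym: "potential_siblings V I \<alpha> \<beta> \<longleftrightarrow> potential_siblings V I \<beta> \<alpha>"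
  unfolding potential_siblings_def by blast

lemma Directed_in_potential_graph_iff:
  assumes "\<alpha> \<in> V" "\<beta> \<in> V"
  shows "Directed \<alpha> \<beta> \<in> edges (potential_graph V I) \<longleftrightarrow> potential_parent V I \<alpha> \<beta>"
  using assms by (auto simp: potential_graph_def)

lemma Bidirected_in_potential_graph_iff:
  assumes "\<alpha> \<in> V" "\<beta> \<in> V"
  shows "Bidirected (Upair \<alpha> \<beta>) \<in> edges (potential_graph V I) \<longleftrightarrow> potential_siblings V I \<alpha> \<beta>"
  using assms potential_siblings_sym by (fastforce simp: potential_graph_def)

lemma is_dmg_potential_graph:
  assumes "finite V"
  shows "is_dmg (potential_graph V I)"
  using assms by (auto simp: is_dmg_def potential_graph_def)

end

theory Submission
  imports Defs
begin

text \<open>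
  Openness of a walk is local, so a \<open>\<mu>\<close>-connecting walk is a run of an automaton whose states pair the
  current node with a flag telling whether the last edge has a head there; the start counts as a
  tail. Edges of a graph satisfy the conditions on potential siblings and parents, since the
  connecting walks can be extended or rerouted along the edge. Conversely, adding a single potential
  edge creates no connection. For \<open>\<alpha> \<leftrightarrow> \<beta>\<close>, the first use of the new edge is replaced by a walk of
  the old graph. For \<open>\<alpha> \<rightarrow> \<beta>\<close>, the new edge may also be traversed backwards and may create ancestors
  of \<open>C\<close>; both are absorbed by (p3) and by the fact that, by (p1) and (p4), every node connected from
  \<open>\<alpha>\<close> is connected from \<open>\<beta>\<close> as well when neither lies in \<open>C\<close>. Hence the potential graph is reached
  from \<open>\<G>\<close> one edge at a time inside the equivalence class, and the graphs in between are covered by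
  monotonicity.
\<close>

section \<open>Walks as runs\<close>

text \<open>Each mark has its own pair of head flags, so an arc still determines the mark; a
  directed loop gives two arcs, one for each orientation.\<close>

definition arc :: "'a dmg \<Rightarrow> 'a \<Rightarrow> bool \<Rightarrow> bool \<Rightarrow> 'a \<Rightarrow> bool" where
  "arc G x s k y \<longleftrightarrow> (\<exists>m. step_edge x m y \<in> edges G \<and> head_at_start m = s \<and> head_at_end m = k)"

text \<open>The set \<open>A\<close> of admissible colliders stands for \<open>An G C\<close>, but
  is a separate parameter so that it can stay fixed while \<open>C\<close> grows.\<close>

definition passable :: "'a set \<Rightarrow> 'a set \<Rightarrow> 'a \<Rightarrow> bool \<Rightarrow> bool \<Rightarrow> bool" where
  "passable A C x h s \<longleftrightarrow> (if h \<and> s then x \<in> A else x \<notin> C)"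

text \<open>A node is tested when it is left: the final state of a run is not tested, and a start
  with flag \<open>False\<close> is tested for lying outside \<open>C\<close>.\<close>

definition moves :: "'a dmg \<Rightarrow> 'a set \<Rightarrow> 'a set \<Rightarrow> (('a \<times> bool) \<times> ('a \<times> bool)) set" where
  "moves G A C = {((x, h), (y, k)) |x h y k. \<exists>s. arc G x s k y \<and> passable A C x h s}"

definition connected_given :: "'a dmg \<Rightarrow> 'a set \<Rightarrow> 'a \<Rightarrow> 'a \<Rightarrow> bool" where
  "connected_given G C a b \<longleftrightarrow> a \<notin> C \<and> ((a, False), (b, True)) \<in> (moves G (An G C) C)\<^sup>*"

lemma arc_iff:
  "arc G x s k y \<longleftrightarrow>
     (\<not> s \<and> k \<and> Directed x y \<in> edges G) \<or> (s \<and> \<not> k \<and> Directed y x \<in> edges G) \<or>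
     (s \<and> k \<and> Bidirected (Upair x y) \<in> edges G)"
proof -
  have "(\<exists>m. P m) \<longleftrightarrow> P Along \<or> P Against \<or> P Both" for P
    using mark.exhaust by metis
  note this[of "\<lambda>m. step_edge x m y \<in> edges G \<and> head_at_start m = s \<and> head_at_end m = k"]
  then show ?thesis
    unfolding arc_def by (simp add: head_at_start_def head_at_end_def) blast
qed

lemma arc_sym: "arc G x s k y \<Longrightarrow> arc G y k s x"
proof -
  have "Upair x y = Upair y x" by simp
  then show "arc G x s k y \<Longrightarrow> arc G y k s x" unfolding arc_iff by metis
qed

lemma arc_verts: "is_dmg G \<Longrightarrow> arc G x s k y \<Longrightarrow> x \<in> verts G \<and> y \<in> verts G"
  unfolding arc_iff is_dmg_def by (elim disjE conjE; drule (1) bspec; simp)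

lemma passable_commute: "passable A C x h s = passable A C x s h"
  by (auto simp: passable_def)

lemma moves_iff [simp]:
  "((x, h), (y, k)) \<in> moves G A C \<longleftrightarrow> (\<exists>s. arc G x s k y \<and> passable A C x h s)"
  by (auto simp: moves_def)

lemma moves_mono:
  assumes "edges G \<subseteq> edges H" "A \<subseteq> A'" "C' \<subseteq> C"
  shows "moves G A C \<subseteq> moves H A' C'"
proof (rule subrelI)
  fix p q assume pq: "(p, q) \<in> moves G A C"
  obtain x h y k where [simp]: "p = (x, h)" "q = (y, k)" by fastforce
  from pq obtain s where "arc G x s k y" "passable A C x h s" by auto
  then have "arc H x s k y" "passable A' C' x h s"
    using assms by (auto simp: arc_def passable_def split: if_splits)
  then show "(p, q) \<in> moves H A' C'" by auto
qed

lemma subset_An: "C \<subseteq> An G C"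
  by (auto simp: An_def)

lemma An_mono:
  assumes "edges G \<subseteq> edges H" "C \<subseteq> D"
  shows "An G C \<subseteq> An H D"
proof -
  have "{(x, y). Directed x y \<in> edges G} \<subseteq> {(x, y). Directed x y \<in> edges H}"
    using assms(1) by auto
  from rtrancl_mono[OF this] assms(2) show ?thesis unfolding An_def by blast
qed

lemma An_step: "Directed x y \<in> edges G \<Longrightarrow> y \<in> An G C \<Longrightarrow> x \<in> An G C"
  unfolding An_def by (auto intro: converse_rtrancl_into_rtrancl)

lemma connected_given_mono:
  assumes "edges G \<subseteq> edges H" "connected_given G C a b"
  shows "connected_given H C a b"
  using assms rtrancl_mono[OF moves_mono[OF assms(1) An_mono[OF assms(1)]]]
  unfolding connected_given_def by blast

text \<open>The flags of the two states differ, so a run between them makes at least one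
  move.\<close>

lemma connected_given_trancl:
  "connected_given G C a b \<longleftrightarrow> a \<notin> C \<and> ((a, False), (b, True)) \<in> (moves G (An G C) C)\<^sup>+"
  by (auto simp: connected_given_def rtrancl_eq_or_trancl)

section \<open>Correspondence between connecting walks and runs\<close>

lemma mu_connecting_imp_connected_given:
  assumes "mu_connecting G C ns ms"
  shows "connected_given G C (hd ns) (last ns)"
proof -
  let ?M = "moves G (An G C) C"
  have len: "length ns = Suc (length ms)" "ms \<noteq> []" and start: "hd ns \<notin> C"
    and edge: "\<And>i. i < length ms \<Longrightarrow> step_edge (ns ! i) (ms ! i) (ns ! Suc i) \<in> edges G"
    and coll: "\<And>i. collider ms i \<Longrightarrow> ns ! i \<in> An G C"
    and noncoll: "\<And>i. noncollider ms i \<Longrightarrow> ns ! i \<notin> C"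
    and last: "head_at_end (last ms)"
    using assms unfolding mu_connecting_def is_walk_def by auto
  have hd: "hd ns = ns ! 0"
    using len by (metis hd_conv_nth list.size(3) nat.distinct(1))
  have arc: "arc G (ns ! i) (head_at_start (ms ! i)) (head_at_end (ms ! i)) (ns ! Suc i)"
    if "i < length ms" for i
    using edge[OF that] unfolding arc_def by blast
  \<comment> \<open>Induction on prefixes: the state after step \<open>j\<close> carries the head
    mark of that step at node \<open>Suc j\<close>, which together with the next mark decides
    whether the node is a collider.\<close>
  have "((hd ns, False), (ns ! Suc j, head_at_end (ms ! j))) \<in> ?M\<^sup>*" if "j < length ms" for j
    using that
  proof (induction j)
    case 0
    have "((hd ns, False), (ns ! Suc 0, head_at_end (ms ! 0))) \<in> ?M"
      using arc[OF 0] start unfolding moves_iff hd passable_def by auto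
    then show ?case by (rule r_into_rtrancl)
  next
    case (Suc j)
    have "passable (An G C) C (ns ! Suc j) (head_at_end (ms ! j)) (head_at_start (ms ! Suc j))"
      using Suc.prems coll[of "Suc j"] noncoll[of "Suc j"]
      by (auto simp: passable_def noncollider_def collider_def)
    with arc[OF Suc.prems]
    have "((ns ! Suc j, head_at_end (ms ! j)), (ns ! Suc (Suc j), head_at_end (ms ! Suc j))) \<in> ?M"
      unfolding moves_iff by blast
    with Suc show ?case by (meson Suc_lessD rtrancl.rtrancl_into_rtrancl)
  qed
  from this[of "length ms - 1"] len(2)
  have "((hd ns, False), (ns ! length ms, head_at_end (last ms))) \<in> ?M\<^sup>*"
    by (simp add: last_conv_nth)
  moreover have "ns ! length ms = last ns"
    using len(1) by (metis diff_Suc_1 last_conv_nth list.size(3) nat.distinct(1))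
  ultimately show ?thesis
    using last start by (simp add: connected_given_def)
qed

text \<open>The final flag is arbitrary because the induction passes through intermediate states of
  both kinds.\<close>

lemma moves_imp_open_walk:
  assumes "is_dmg G" "a \<notin> C" "((a, False), (b, h)) \<in> (moves G (An G C) C)\<^sup>+"
  shows "\<exists>ns ms. is_walk G ns ms \<and> ms \<noteq> [] \<and> hd ns = a \<and> last ns = b \<and>
           head_at_end (last ms) = h \<and>
           (\<forall>i. collider ms i \<longrightarrow> ns ! i \<in> An G C) \<and> (\<forall>i. noncollider ms i \<longrightarrow> ns ! i \<notin> C)"
  using assms(3)
proof (induction "(b, h)" arbitrary: b h rule: trancl_induct)
  case (base b h)
  then obtain s where arc: "arc G a s h b" by auto
  then obtain m where m: "step_edge a m b \<in> edges G" "head_at_end m = h"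
    unfolding arc_def by blast
  then show ?case
    using arc_verts[OF assms(1) arc]
    by (intro exI[of _ "[a, b]"] exI[of _ "[m]"])
       (auto simp: is_walk_def collider_def noncollider_def)
next
  case (step y z k)
  obtain x h where y: "y = (x, h)" by (cases y)
  obtain ns ms where w: "is_walk G ns ms" "ms \<noteq> []" "hd ns = a" "last ns = x"
      "head_at_end (last ms) = h" "\<And>i. collider ms i \<Longrightarrow> ns ! i \<in> An G C"
      "\<And>i. noncollider ms i \<Longrightarrow> ns ! i \<notin> C"
    using step(3)[OF y] by blast
  from step(2) y obtain s where arc: "arc G x s k z" and pass: "passable (An G C) C x h s"
    by auto
  then obtain m where m: "step_edge x m z \<in> edges G" "head_at_start m = s" "head_at_end m = k"
    unfolding arc_def by blast
  have len: "length ns = Suc (length ms)" "ns \<noteq> []"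
    using w(1) by (auto simp: is_walk_def)
  have x: "ns ! length ms = x"
    using w(4) len by (simp add: last_conv_nth)
  have h: "head_at_end (ms ! (length ms - 1)) = h"
    using w(2,5) by (simp add: last_conv_nth)
  have "is_walk G (ns @ [z]) (ms @ [m])"
    using w(1) m x arc_verts[OF assms(1) arc]
    by (auto simp: is_walk_def nth_append less_Suc_eq)
  \<comment> \<open>Appending a step turns just one position into an inner one, the old end
    \<open>length ms\<close>; its condition is the passability test of the move.\<close>
  moreover have "(ns @ [z]) ! i \<in> An G C" if "collider (ms @ [m]) i" for i
  proof (cases "i < length ms")
    case True
    with that w(6)[of i] show ?thesis
      using len by (auto simp: collider_def nth_append less_imp_diff_less)
  next
    case False
    with that have "i = length ms" by (auto simp: collider_def)
    with that pass m h x len w(2) show ?thesis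
      by (auto simp: collider_def nth_append passable_def)
  qed
  moreover have "(ns @ [z]) ! i \<notin> C" if "noncollider (ms @ [m]) i" for i
  proof (cases "i < length ms")
    case True
    with that w(7)[of i] show ?thesis
      using len by (auto simp: collider_def noncollider_def nth_append less_imp_diff_less)
  next
    case False
    with that have "i = length ms" by (auto simp: noncollider_def)
    with that pass m h x len w(2) show ?thesis
      by (auto simp: collider_def noncollider_def nth_append passable_def split: if_splits)
  qed
  ultimately show ?case
    using w(3) m(3) len by (intro exI[of _ "ns @ [z]"] exI[of _ "ms @ [m]"]) auto
qed

lemma in_indep_model_iff:
  assumes "is_dmg G"
  shows "(A, B, C) \<in> indep_model G \<longleftrightarrow> A \<subseteq> verts G \<and> B \<subseteq> verts G \<and> C \<subseteq> verts G \<and>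
           (\<forall>a\<in>A. \<forall>b\<in>B. \<not> connected_given G C a b)"
proof -
  have "(\<exists>ns ms. hd ns = a \<and> last ns = b \<and> mu_connecting G C ns ms) \<longleftrightarrow> connected_given G C a b"
    (is "?L \<longleftrightarrow> ?R") for a b
  proof
    assume ?L
    then show ?R using mu_connecting_imp_connected_given by metis
  next
    assume R: ?R
    then have "a \<notin> C" "((a, False), (b, True)) \<in> (moves G (An G C) C)\<^sup>+"
      by (auto simp: connected_given_trancl)
    from this(1) moves_imp_open_walk[OF assms this] show ?L
      unfolding mu_connecting_def by metis
  qed
  then have "mu_separated G A B C \<longleftrightarrow> (\<forall>a\<in>A. \<forall>b\<in>B. \<not> connected_given G C a b)"
    unfolding mu_separated_def by simp
  then show ?thesis by (simp add: indep_model_def)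
qed

lemma indep_model_eqI:
  assumes "is_dmg G" "is_dmg H" "verts G = verts H"
    and "\<And>C a b. C \<subseteq> verts G \<Longrightarrow> a \<in> verts G \<Longrightarrow> b \<in> verts G \<Longrightarrow>
           connected_given G C a b \<longleftrightarrow> connected_given H C a b"
  shows "indep_model G = indep_model H"
proof -
  have "(\<forall>a\<in>A. \<forall>b\<in>B. \<not> connected_given G C a b) \<longleftrightarrow> (\<forall>a\<in>A. \<forall>b\<in>B. \<not> connected_given H C a b)"
    if "A \<subseteq> verts G" "B \<subseteq> verts G" "C \<subseteq> verts G" for A B C
    using that by (intro ball_cong refl) (simp add: assms(4) subset_iff)
  then have "(A, B, C) \<in> indep_model G \<longleftrightarrow> (A, B, C) \<in> indep_model H" for A B C
    unfolding in_indep_model_iff[OF assms(1)] in_indep_model_iff[OF assms(2)] assms(3)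
    by (simp cong: conj_cong)
  then show ?thesis by (intro set_eqI) (simp add: split_paired_all)
qed

lemma in_indep_model_singletons_iff:
  assumes "is_dmg G" "a \<in> verts G" "b \<in> verts G" "C \<subseteq> verts G"
  shows "({a}, {b}, C) \<in> indep_model G \<longleftrightarrow> \<not> connected_given G C a b"
  using assms by (simp add: in_indep_model_iff)

section \<open>Edges are potential edges\<close>

lemma inseparable_iff:
  assumes "is_dmg G" "\<alpha> \<in> verts G" "\<beta> \<in> verts G"
  shows "\<alpha> \<in> u (verts G) (indep_model G) \<beta> \<longleftrightarrow>
     (\<forall>C\<subseteq>verts G. \<alpha> \<notin> C \<longrightarrow> connected_given G C \<alpha> \<beta>)"
  using assms in_indep_model_singletons_iff[OF assms]
  unfolding u_def separable_def by (auto simp: subset_Diff_insert)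

lemma potential_siblings_iff:
  assumes "is_dmg G" "\<alpha> \<in> verts G" "\<beta> \<in> verts G"
  shows "potential_siblings (verts G) (indep_model G) \<alpha> \<beta> \<longleftrightarrow>
     (\<forall>C\<subseteq>verts G. \<beta> \<notin> C \<longrightarrow> connected_given G C \<beta> \<alpha>) \<and>
     (\<forall>C\<subseteq>verts G. \<alpha> \<notin> C \<longrightarrow> connected_given G C \<alpha> \<beta>) \<and>
     (\<forall>\<gamma>\<in>verts G. \<forall>C\<subseteq>verts G. \<beta> \<in> C \<longrightarrow> connected_given G C \<gamma> \<beta> \<longrightarrow> connected_given G C \<gamma> \<alpha>) \<and>
     (\<forall>\<gamma>\<in>verts G. \<forall>C\<subseteq>verts G. \<alpha> \<in> C \<longrightarrow> connected_given G C \<gamma> \<alpha> \<longrightarrow> connected_given G C \<gamma> \<beta>)"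
  unfolding potential_siblings_def inseparable_iff[OF assms] inseparable_iff[OF assms(1,3,2)]
  using assms
  by (intro conj_cong ball_cong all_cong refl)
     (auto simp: in_indep_model_singletons_iff)

text \<open>Contraposition turns the conditions into rules that create connections. In particular,
  (p3) joins a walk into \<beta> \<in> C to a walk leaving \<alpha>, just as a step \<beta>
  \<leftarrow> \<alpha> would.\<close>

lemma potential_parent_iff:
  assumes "is_dmg G" "\<alpha> \<in> verts G" "\<beta> \<in> verts G"
  shows "potential_parent (verts G) (indep_model G) \<alpha> \<beta> \<longleftrightarrow>
     (\<forall>C\<subseteq>verts G. \<alpha> \<notin> C \<longrightarrow> connected_given G C \<alpha> \<beta>) \<and>
     (\<forall>\<gamma>\<in>verts G. \<forall>C\<subseteq>verts G. \<alpha> \<notin> C \<longrightarrow> connected_given G C \<gamma> \<alpha> \<longrightarrow> connected_given G C \<gamma> \<beta>) \<and>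
     (\<forall>\<gamma>\<in>verts G. \<forall>\<delta>\<in>verts G. \<forall>C\<subseteq>verts G. \<alpha> \<notin> C \<longrightarrow> \<beta> \<in> C \<longrightarrow>
        connected_given G C \<gamma> \<beta> \<longrightarrow> connected_given G C \<alpha> \<delta> \<longrightarrow> connected_given G C \<gamma> \<delta>) \<and>
     (\<forall>\<gamma>\<in>verts G. \<forall>C\<subseteq>verts G. \<alpha> \<notin> C \<longrightarrow>
        connected_given G (insert \<alpha> C) \<beta> \<gamma> \<longrightarrow> connected_given G C \<beta> \<gamma>)"
  unfolding potential_parent_def inseparable_iff[OF assms]
  using assms
  by (intro conj_cong ball_cong all_cong refl)
     (auto simp: in_indep_model_singletons_iff)

section \<open>The conditions verified for existing edges\<close>

lemma connected_given_step:
  assumes "((a, False), (x, h)) \<in> (moves G (An G C) C)\<^sup>*" "a \<notin> C"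
    "arc G x s True y" "passable (An G C) C x h s"
  shows "connected_given G C a y"
proof -
  have "((x, h), (y, True)) \<in> moves G (An G C) C"
    using assms(3,4) by auto
  with assms(1,2) show ?thesis
    unfolding connected_given_def by (meson rtrancl.rtrancl_into_rtrancl)
qed

text \<open>From a node outside \<open>C\<close> the edge alone connects. A connection to a node of
  \<open>C\<close> ends with a head there, and appending the edge makes that node a collider, open
  because it lies in \<open>C\<close>.\<close>

lemma edge_imp_potential_siblings:
  assumes "is_dmg G" "Bidirected (Upair \<alpha> \<beta>) \<in> edges G"
  shows "potential_siblings (verts G) (indep_model G) \<alpha> \<beta>"
proof -
  have arc: "arc G \<alpha> True True \<beta>"
    using assms(2) by (simp add: arc_iff)
  note arcs = arc arc_sym[OF arc]
  have start: "connected_given G C x y" if "x \<notin> C" "arc G x True True y" for C x y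
    using that by (intro connected_given_step[of x x False]) (auto simp: passable_def)
  have ext: "connected_given G C \<gamma> y"
    if "x \<in> C" "arc G x True True y" "connected_given G C \<gamma> x" for C \<gamma> x y
    using that subset_An[of C G]
    by (intro connected_given_step[of \<gamma> x True]) (auto simp: passable_def connected_given_def)
  show ?thesis
    using arcs start ext arc_verts[OF assms(1) arc] by (simp add: potential_siblings_iff[OF assms(1)])
qed

lemma directed_path_moves:
  assumes "(x, y) \<in> {(x, y). Directed x y \<in> edges G}\<^sup>*" "x \<notin> An G C"
  shows "y \<notin> An G C" "((x, True), (y, True)) \<in> (moves G (An G C) C)\<^sup>*"
    "((y, False), (x, False)) \<in> (moves G (An G C) C)\<^sup>*"
proof -
  let ?M = "moves G (An G C) C"
  have "y \<notin> An G C \<and> ((x, True), (y, True)) \<in> ?M\<^sup>* \<and> ((y, False), (x, False)) \<in> ?M\<^sup>*"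
    using assms
  proof (induction rule: converse_rtrancl_induct)
    case base
    then show ?case by simp
  next
    case (step x z)
    then have e: "Directed x z \<in> edges G" by simp
    have z: "z \<notin> An G C" using An_step[OF e] step.prems by blast
    have "((x, True), (z, True)) \<in> ?M" "((z, False), (x, False)) \<in> ?M"
      using e z step.prems subset_An[of C G] by (auto simp: arc_iff passable_def)
    with step.IH[OF z] show ?case
      by (meson converse_rtrancl_into_rtrancl rtrancl.rtrancl_into_rtrancl)
  qed
  then show "y \<notin> An G C" "((x, True), (y, True)) \<in> ?M\<^sup>*" "((y, False), (x, False)) \<in> ?M\<^sup>*"
    by auto
qed

text \<open>A collider whose only descendant in \<open>C \<union> {\<alpha>}\<close> is \<open>\<alpha>\<close> is bypassed by \<open>\<beta> \<leftarrow> \<alpha> \<leftarrow> \<cdots>\<close>.\<close>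

lemma connected_given_parent_removed:
  assumes e: "Directed \<alpha> \<beta> \<in> edges G" and "\<alpha> \<notin> C"
    and conn: "connected_given G (insert \<alpha> C) \<beta> \<gamma>"
  shows "connected_given G C \<beta> \<gamma>"
proof -
  let ?M = "moves G (An G C) C" and ?C = "insert \<alpha> C"
  have \<beta>: "\<beta> \<notin> C" using conn by (simp add: connected_given_def)
  have "((\<beta>, False), (x, h)) \<in> ?M\<^sup>*" if "((\<beta>, False), (x, h)) \<in> (moves G (An G ?C) ?C)\<^sup>*" for x h
    using that
  proof (induction "(x, h)" arbitrary: x h rule: rtrancl_induct)
    case base
    then show ?case by simp
  next
    case (step p y k)
    obtain x h where p: "p = (x, h)" by (cases p)
    from step(2) p obtain s where s: "arc G x s k y" "passable (An G ?C) ?C x h s" by auto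
    show ?case
    proof (cases "passable (An G C) C x h s")
      case True
      with s(1) have "((x, h), (y, k)) \<in> ?M" by auto
      with step(3)[OF p] show ?thesis by (rule rtrancl.rtrancl_into_rtrancl)
    next
      case False
      \<comment> \<open>A noncollider that passes the test for \<open>?C\<close> also passes it for
        \<open>C\<close>, so \<open>x\<close> must be a collider here.\<close>
      with s(2) have x: "x \<notin> An G C" "x \<in> An G ?C"
        by (auto simp: passable_def split: if_splits)
      then have "(x, \<alpha>) \<in> {(x, y). Directed x y \<in> edges G}\<^sup>*"
        by (auto simp: An_def)
      then have up: "((\<alpha>, False), (x, False)) \<in> ?M\<^sup>*"
        using directed_path_moves x(1) by metis
      \<comment> \<open>The run so far is dropped: \<beta> \<leftarrow> \<alpha> starts afresh, and
        \<open>x\<close> is then reached by a tail, as a noncollider outside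
        \<open>C\<close>.\<close>
      have "((\<beta>, False), (\<alpha>, False)) \<in> ?M"
        using e \<beta> by (auto simp: arc_iff passable_def)
      moreover have "((x, False), (y, k)) \<in> ?M"
        using s(1) x(1) subset_An[of C G] by (auto simp: passable_def)
      ultimately show ?thesis
        using up by (meson converse_rtrancl_into_rtrancl rtrancl.rtrancl_into_rtrancl)
    qed
  qed
  with conn \<beta> show ?thesis by (simp add: connected_given_def)
qed

text \<open>The edge itself gives (p1). Appended to a walk into \<alpha> it leaves \<alpha> by a
  tail, which gives (p2). For (p3), continuing with \<beta> \<leftarrow> \<alpha> makes \<beta>
  \<in> C an open collider. (p4) is \<open>connected_given_parent_removed\<close>.\<close>

lemma edge_imp_potential_parent:
  assumes G: "is_dmg G" and e: "Directed \<alpha> \<beta> \<in> edges G"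
  shows "potential_parent (verts G) (indep_model G) \<alpha> \<beta>"
proof -
  have arc: "arc G \<alpha> False True \<beta>" using e by (simp add: arc_iff)
  have p1: "connected_given G C \<alpha> \<beta>" if "\<alpha> \<notin> C" for C
    using that arc by (intro connected_given_step[of \<alpha> \<alpha> False]) (auto simp: passable_def)
  have p2: "connected_given G C \<gamma> \<beta>" if "\<alpha> \<notin> C" "connected_given G C \<gamma> \<alpha>" for C \<gamma>
    using that arc
    by (intro connected_given_step[of \<gamma> \<alpha> True]) (auto simp: passable_def connected_given_def)
  have p3: "connected_given G C \<gamma> \<delta>"
    if "\<beta> \<in> C" "connected_given G C \<gamma> \<beta>" "connected_given G C \<alpha> \<delta>" for C \<gamma> \<delta>
  proof -
    \<comment> \<open>Entering \<alpha> by a tail leads to the very state in which a walk from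
      \<alpha> starts.\<close>
    have "((\<beta>, True), (\<alpha>, False)) \<in> moves G (An G C) C"
      using that(1) arc_sym[OF arc] subset_An[of C G] by (auto simp: passable_def)
    with that show ?thesis
      unfolding connected_given_def by (meson converse_rtrancl_into_rtrancl rtrancl_trans)
  qed
  show ?thesis
    unfolding potential_parent_iff[OF G arc_verts[OF G arc, THEN conjunct1]
        arc_verts[OF G arc, THEN conjunct2]]
    by (intro conjI ballI allI impI;
        (rule p1 p2 p3 connected_given_parent_removed[OF e]; assumption))
qed

lemma finite_edges:
  assumes "is_dmg G"
  shows "finite (edges G)"
proof (rule finite_subset)
  let ?P = "verts G \<times> verts G"
  show "edges G \<subseteq> case_prod Directed ` ?P \<union> (\<lambda>(a, b). Bidirected (Upair a b)) ` ?P"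
  proof
    fix e assume e: "e \<in> edges G"
    then have ends: "ends e \<subseteq> verts G" using assms by (auto simp: is_dmg_def)
    show "e \<in> case_prod Directed ` ?P \<union> (\<lambda>(a, b). Bidirected (Upair a b)) ` ?P"
    proof (cases e)
      case (Directed a b)
      with ends show ?thesis by auto
    next
      case (Bidirected p)
      with ends show ?thesis by (cases p) auto
    qed
  qed
  show "finite (case_prod Directed ` ?P \<union> (\<lambda>(a, b). Bidirected (Upair a b)) ` ?P)"
    using assms by (auto simp: is_dmg_def)
qed

lemma edges_subset_potential_graph:
  assumes "is_dmg G"
  shows "edges G \<subseteq> edges (potential_graph (verts G) (indep_model G))"
proof
  fix e assume e: "e \<in> edges G"
  then have ends: "ends e \<subseteq> verts G" using assms by (auto simp: is_dmg_def)
  show "e \<in> edges (potential_graph (verts G) (indep_model G))"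
  proof (cases e)
    case (Directed a b)
    with e ends show ?thesis
      using edge_imp_potential_parent[OF assms] by (auto simp: Directed_in_potential_graph_iff)
  next
    case (Bidirected p)
    obtain a b where "p = Upair a b" by (cases p)
    with Bidirected e ends show ?thesis
      using edge_imp_potential_siblings[OF assms] by (auto simp: Bidirected_in_potential_graph_iff)
  qed
qed

section \<open>Adding a potential edge\<close>

lemma moves_change_flag:
  assumes "((x, False), q) \<in> (moves G A C)\<^sup>+" "h \<longrightarrow> x \<in> A"
  shows "((x, h), q) \<in> (moves G A C)\<^sup>+"
proof -
  obtain p where p: "((x, False), p) \<in> moves G A C" "(p, q) \<in> (moves G A C)\<^sup>*"
    using tranclD[OF assms(1)] by blast
  obtain y k where [simp]: "p = (y, k)" by (cases p)
  \<comment> \<open>With flag \<open>False\<close> the test is \<open>x \<notin> C\<close> whatever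
    the first arc; flag \<open>True\<close> adds only the collider case, where
    \<open>x \<in> A\<close> is demanded.\<close>
  from p(1) obtain s where s: "arc G x s k y" "x \<notin> C" by (auto simp: passable_def)
  have "passable A C x h s" using s(2) assms(2) by (simp add: passable_def)
  with s(1) have "((x, h), p) \<in> moves G A C" by auto
  then show ?thesis using p(2) by (rule rtrancl_into_trancl2)
qed

text \<open>Arcs can be reversed and passability is symmetric in its two flags, so inner nodes keep
  their status. Only the ends change: the test at \<open>x\<close> is handed back with
  \<open>s\<close>, the head flag of the first arc there, and \<open>y\<close> must now be passable
  when entered with \<open>l\<close>.\<close>

lemma moves_reverse:
  assumes "((x, h), (y, k)) \<in> (moves G A C)\<^sup>+"
  shows "\<exists>s. passable A C x h s \<and>
           (\<forall>l. passable A C y l k \<longrightarrow> ((y, l), (x, s)) \<in> (moves G A C)\<^sup>+)"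
  using assms
proof (induction "(y, k)" arbitrary: y k rule: trancl_induct)
  case (base y k)
  then obtain s where "arc G x s k y" "passable A C x h s" by auto
  from this(1) have "arc G y k s x" by (rule arc_sym)
  with \<open>passable A C x h s\<close> show ?case by (intro exI[of _ s]) (auto intro!: r_into_trancl)
next
  case (step p z k')
  obtain y k where p: "p = (y, k)" by (cases p)
  from step(2) p obtain t where t: "arc G y t k' z" "passable A C y k t" by auto
  from t(2) have "passable A C y t k" by (subst passable_commute)
  with step(3)[OF p] obtain s where s: "passable A C x h s"
    "((y, t), (x, s)) \<in> (moves G A C)\<^sup>+" by blast
  have "((z, l), (x, s)) \<in> (moves G A C)\<^sup>+" if "passable A C z l k'" for l
  proof -
    have "((z, l), (y, t)) \<in> moves G A C" using arc_sym[OF t(1)] that by auto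
    then show ?thesis using s(2) by (rule trancl_into_trancl2)
  qed
  with s(1) show ?case by blast
qed

text \<open>After the last departure from \<alpha> only other nodes are left, so \<alpha> can join
  the forbidden set while the collider set \<open>A\<close> stays as it is.\<close>

lemma moves_last_departure:
  assumes "((\<alpha>, False), (z, l)) \<in> (moves G A C)\<^sup>+"
  shows "\<exists>s k y. arc G \<alpha> s k y \<and> ((y, k), (z, l)) \<in> (moves G A (insert \<alpha> C))\<^sup>*"
  using assms
proof (induction "(z, l)" arbitrary: z l rule: trancl_induct)
  case (base z l)
  then obtain s where "arc G \<alpha> s l z" by auto
  then show ?case by blast
next
  case (step p z l)
  obtain x h where p: "p = (x, h)" by (cases p)
  from step(2) p obtain t where t: "arc G x t l z" "passable A C x h t" by auto
  show ?case
  proof (cases "x = \<alpha>")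
    case True
    with t(1) show ?thesis by blast
  next
    case False
    with t have "((x, h), (z, l)) \<in> moves G A (insert \<alpha> C)"
      by (auto simp: passable_def split: if_splits)
    with step(3)[OF p] show ?thesis by (meson rtrancl.rtrancl_into_rtrancl)
  qed
qed

text \<open>
  The reversed walk from \<open>\<beta>\<close> to \<open>\<alpha>\<close> is glued to the walk leaving \<open>\<alpha>\<close>, both cut so that \<open>\<alpha>\<close> occurs
  only at the junction. Either \<open>\<alpha>\<close> is a noncollider there, or the glued walk is connecting given
  \<open>C \<union> {\<alpha>}\<close> and (p4) applies.
\<close>

lemma connected_given_from_child:
  assumes "\<alpha> \<notin> C" "\<beta> \<notin> C"
    and p1: "connected_given G C \<alpha> \<beta>"
    and p4: "connected_given G (insert \<alpha> C) \<beta> \<delta> \<Longrightarrow> connected_given G C \<beta> \<delta>"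
    and conn: "connected_given G C \<alpha> \<delta>"
  shows "connected_given G C \<beta> \<delta>"
proof (cases "\<alpha> = \<beta>")
  case True
  with conn show ?thesis by simp
next
  case False
  let ?A = "An G C" and ?C = "insert \<alpha> C"
  have \<beta>: "\<beta> \<notin> ?C" using False assms(2) by simp
  obtain s k y where s: "arc G \<alpha> s k y" "((y, k), (\<beta>, True)) \<in> (moves G ?A ?C)\<^sup>*"
    using p1 moves_last_departure unfolding connected_given_trancl by meson
  obtain s' k' y' where s': "arc G \<alpha> s' k' y'" "((y', k'), (\<delta>, True)) \<in> (moves G ?A ?C)\<^sup>*"
    using conn moves_last_departure unfolding connected_given_trancl by meson
  have return: "((\<beta>, False), (\<alpha>, s)) \<in> (moves G ?A ?C)\<^sup>*"
  \<comment> \<open>If the last departure from \<alpha> already ends the run, there is a single arc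
    to reverse; otherwise \<open>moves_reverse\<close> handles the nonempty rest.\<close>
  proof (cases "(y, k) = (\<beta>, True)")
    case True
    with arc_sym[OF s(1)] \<beta> have "((\<beta>, False), (\<alpha>, s)) \<in> moves G ?A ?C"
      by (auto simp: passable_def)
    then show ?thesis by (rule r_into_rtrancl)
  next
    case False
    with s(2) have "((y, k), (\<beta>, True)) \<in> (moves G ?A ?C)\<^sup>+"
      by (metis rtranclD)
    from moves_reverse[OF this] \<beta> obtain t where
      t: "passable ?A ?C y k t" "((\<beta>, False), (y, t)) \<in> (moves G ?A ?C)\<^sup>+"
      by (auto simp: passable_def)
    have "((y, t), (\<alpha>, s)) \<in> moves G ?A ?C"
      using arc_sym[OF s(1)] t(1)[unfolded passable_commute[of _ _ _ k]] by auto
    with t(2) show ?thesis by (meson rtrancl.rtrancl_into_rtrancl trancl_into_rtrancl)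
  qed
  \<comment> \<open>\<open>B\<close> and \<open>D\<close> stay open because at the junction \<alpha>
    is passable given \<open>?C\<close> as a collider, but given \<open>C\<close> as a
    noncollider.\<close>
  have glue: "((\<beta>, False), (\<delta>, True)) \<in> (moves G B D)\<^sup>*"
    if "?A \<subseteq> B" "D \<subseteq> ?C" "passable B D \<alpha> s s'" for B D
  proof -
    have "((\<alpha>, s), (y', k')) \<in> moves G B D" using s'(1) that(3) by auto
    moreover have "(moves G ?A ?C)\<^sup>* \<subseteq> (moves G B D)\<^sup>*"
      by (intro rtrancl_mono moves_mono) (use that in auto)
    ultimately show ?thesis
      using return s'(2) by (meson converse_rtrancl_into_rtrancl rtrancl_trans subsetD)
  qed
  show ?thesis
  proof (cases "s \<and> s'")
    case True
    have "\<alpha> \<in> An G ?C" using subset_An[of ?C G] by blast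
    with True have "((\<beta>, False), (\<delta>, True)) \<in> (moves G (An G ?C) ?C)\<^sup>*"
      by (intro glue An_mono) (auto simp: passable_def)
    with \<beta> have "connected_given G ?C \<beta> \<delta>" by (simp add: connected_given_def)
    then show ?thesis by (rule p4)
  next
    case False
    with \<open>\<alpha> \<notin> C\<close> have "((\<beta>, False), (\<delta>, True)) \<in> (moves G ?A C)\<^sup>*"
      by (intro glue) (auto simp: passable_def)
    with \<open>\<beta> \<notin> C\<close> show ?thesis by (simp add: connected_given_def)
  qed
qed

lemma connected_given_extend:
  assumes "((\<gamma>, False), (x, h)) \<in> (moves G (An G C) C)\<^sup>*" "\<gamma> \<notin> C"
    and "connected_given G C x y" "h \<longrightarrow> x \<in> An G C"
  shows "connected_given G C \<gamma> y"
  using assms moves_change_flag[of x "(y, True)" G "An G C" C h]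
  unfolding connected_given_trancl by (meson rtrancl_trancl_trancl)

section \<open>One new bidirected edge\<close>

lemma connected_given_insert_siblings:
  assumes G: "is_dmg G" and V: "\<alpha> \<in> verts G" "\<beta> \<in> verts G"
    and pot: "potential_siblings (verts G) (indep_model G) \<alpha> \<beta>"
    and H: "edges H = insert (Bidirected (Upair \<alpha> \<beta>)) (edges G)"
    and C: "C \<subseteq> verts G" and \<gamma>: "\<gamma> \<in> verts G" and conn: "connected_given H C \<gamma> \<delta>"
  shows "connected_given G C \<gamma> \<delta>"
proof -
  let ?M = "moves G (An G C) C"
  note pot = pot[unfolded potential_siblings_iff[OF G V]]
  \<comment> \<open>A bidirected edge adds no ancestors, so only its own traversals need
    replacing.\<close>
  have An: "An H C = An G C" by (simp add: An_def H)
  have "\<gamma> \<notin> C" using conn by (simp add: connected_given_def)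
  \<comment> \<open>The replacement ends with a head at \<open>y\<close>, in the same state as the
    new edge, so the rest of the run is unaffected.\<close>
  have new: "((\<gamma>, False), (y, True)) \<in> ?M\<^sup>*"
    if "(x, y) = (\<alpha>, \<beta>) \<or> (x, y) = (\<beta>, \<alpha>)" "((\<gamma>, False), (x, h)) \<in> ?M\<^sup>*"
      "passable (An G C) C x h True" for x y h
  proof -
    have insep: "x \<notin> C \<Longrightarrow> connected_given G C x y"
      and mono: "x \<in> C \<Longrightarrow> connected_given G C \<gamma> x \<Longrightarrow> connected_given G C \<gamma> y"
      using pot that(1) C \<gamma> by auto
    have "connected_given G C \<gamma> y"
    proof (cases "x \<in> C")
      \<comment> \<open>A node of \<open>C\<close> reached here is passable only as a collider or
        fails the test, so the prefix has a head at \<open>x\<close> and is itself a connection;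
        (s2) or (s3) carries it to \<open>y\<close>.\<close>
      case True
      with that(2,3) \<open>\<gamma> \<notin> C\<close> have "connected_given G C \<gamma> x"
        by (cases h) (auto simp: passable_def connected_given_def)
      with True show ?thesis by (rule mono)
    next
      case False
      with that \<open>\<gamma> \<notin> C\<close> insep show ?thesis
        by (intro connected_given_extend[of \<gamma> x h]) (auto simp: passable_def)
    qed
    then show ?thesis by (simp add: connected_given_def)
  qed
  have "((\<gamma>, False), (x, h)) \<in> ?M\<^sup>*" if "((\<gamma>, False), (x, h)) \<in> (moves H (An H C) C)\<^sup>*" for x h
    using that
  proof (induction "(x, h)" arbitrary: x h rule: rtrancl_induct)
    case base
    then show ?case by simp
  next
    case (step p y k)
    obtain x h where p: "p = (x, h)" by (cases p)
    from step(2) p An obtain s where s: "arc H x s k y" "passable (An G C) C x h s" by auto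
    show ?case
    proof (cases "arc G x s k y")
      case True
      with s(2) have "((x, h), (y, k)) \<in> ?M" by auto
      with step(3)[OF p] show ?thesis by (rule rtrancl.rtrancl_into_rtrancl)
    next
      case False
      with s(1) H have "s" "k" "(x, y) = (\<alpha>, \<beta>) \<or> (x, y) = (\<beta>, \<alpha>)"
        by (auto simp: arc_iff)
      with new[of x y h] step(3)[OF p] s(2) show ?thesis by simp
    qed
  qed
  with conn show ?thesis by (simp add: connected_given_def)
qed

section \<open>One new directed edge\<close>

lemma An_insert_Directed:
  assumes H: "edges H = insert (Directed \<alpha> \<beta>) (edges G)" and "x \<in> An H C"
  shows "x \<in> An G C \<or> \<beta> \<in> An G C \<and> (x, \<alpha>) \<in> {(x, y). Directed x y \<in> edges G}\<^sup>*"
proof -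
  obtain c where "c \<in> C" and path: "(x, c) \<in> {(x, y). Directed x y \<in> edges H}\<^sup>*"
    using assms(2) by (auto simp: An_def)
  \<comment> \<open>A path through the new edge reaches \<alpha> within \<open>G\<close> before the
    first use, and what follows the last use puts \<beta> into \<open>An G C\<close>.\<close>
  from path show ?thesis
  proof (induction rule: converse_rtrancl_induct)
    case base
    then show ?case using \<open>c \<in> C\<close> subset_An[of C G] by auto
  next
    case (step x z)
    then consider "Directed x z \<in> edges G" | "x = \<alpha>" "z = \<beta>" using H by auto
    then show ?case
    proof cases
      case 1
      then have "(x, z) \<in> {(x, y). Directed x y \<in> edges G}" by simp
      with step.IH An_step[OF 1] show ?thesis by (meson converse_rtrancl_into_rtrancl)
    next
      case 2
      with step.IH show ?thesis by auto
    qed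
  qed
qed

text \<open>The induction runs from the end, with \<gamma> arbitrary: at a backward use of the new
  edge, or at a collider opened only by it, the rest of the run first becomes a connection from
  another node, and the prefix is attached afterwards.\<close>

lemma connected_given_insert_parent:
  assumes G: "is_dmg G" and V: "\<alpha> \<in> verts G" "\<beta> \<in> verts G"
    and pot: "potential_parent (verts G) (indep_model G) \<alpha> \<beta>"
    and H: "edges H = insert (Directed \<alpha> \<beta>) (edges G)"
    and C: "C \<subseteq> verts G" and \<gamma>: "\<gamma> \<in> verts G" and \<delta>: "\<delta> \<in> verts G"
    and conn: "connected_given H C \<gamma> \<delta>"
  shows "connected_given G C \<gamma> \<delta>"
proof -
  let ?A = "An G C" and ?M = "moves G (An G C) C"
  note pot = pot[unfolded potential_parent_iff[OF G V]]
  have p1: "connected_given G C \<alpha> \<beta>" if "\<alpha> \<notin> C"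
    by (rule conjunct1[OF pot, rule_format]) (use C that in auto)
  have p2: "connected_given G C \<gamma> \<beta>" if "\<alpha> \<notin> C" "connected_given G C \<gamma> \<alpha>" "\<gamma> \<in> verts G" for \<gamma>
    by (rule pot[THEN conjunct2, THEN conjunct1, rule_format]) (use C that in auto)
  have p3: "connected_given G C \<gamma> \<delta>" if "\<alpha> \<notin> C" "\<beta> \<in> C" "connected_given G C \<gamma> \<beta>"
    "connected_given G C \<alpha> \<delta>" "\<gamma> \<in> verts G" for \<gamma>
    by (rule pot[THEN conjunct2, THEN conjunct2, THEN conjunct1, rule_format])
       (use C \<delta> that in auto)
  have p4: "connected_given G C \<beta> \<delta>" if "\<alpha> \<notin> C" "connected_given G (insert \<alpha> C) \<beta> \<delta>"
    by (rule pot[THEN conjunct2, THEN conjunct2, THEN conjunct2, rule_format])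
       (use C \<delta> that in auto)
  \<comment> \<open>Substitute for a step \<beta> \<leftarrow> \<alpha>. If \<beta> \<in> C, the
    prefix has a head at \<beta> and (p3) applies; otherwise
    \<open>connected_given_from_child\<close> moves the start of the rest from \<alpha> to
    \<beta>.\<close>
  have via: "connected_given G C \<gamma> \<delta>"
    if "\<gamma> \<in> verts G" "\<gamma> \<notin> C" "\<alpha> \<notin> C" "((\<gamma>, False), (\<beta>, h)) \<in> ?M\<^sup>*" "passable ?A C \<beta> h True"
      "connected_given G C \<alpha> \<delta>" for \<gamma> h
  proof (cases "\<beta> \<in> C")
    case True
    with that have "connected_given G C \<gamma> \<beta>"
      by (cases h) (auto simp: passable_def connected_given_def)
    with that True show ?thesis by (simp add: p3)
  next
    case False
    with that(3,6) have "connected_given G C \<beta> \<delta>"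
      using connected_given_from_child[OF that(3) False p1[OF that(3)] p4[OF that(3)]] by blast
    with that show ?thesis
      by (intro connected_given_extend[of \<gamma> \<beta> h]) (auto simp: passable_def)
  qed
  have "connected_given G C \<gamma> \<delta>"
    if "((x, h), (\<delta>, True)) \<in> (moves H (An H C) C)\<^sup>*"
      "\<gamma> \<in> verts G" "\<gamma> \<notin> C" "((\<gamma>, False), (x, h)) \<in> ?M\<^sup>*" for \<gamma> x h
    using that
  proof (induction "(x, h)" arbitrary: \<gamma> x h rule: converse_rtrancl_induct)
    case base
    then show ?case by (simp add: connected_given_def)
  next
    case (step q)
    obtain y k where q: "q = (y, k)" by (cases q)
    note IH = step(3)[OF q]
    note prefix = step.prems(3)
    from step(1) q obtain s where s: "arc H x s k y" "passable (An H C) C x h s" by auto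
    from s(1) H consider (old) "arc G x s k y" | (forward) "x = \<alpha>" "y = \<beta>" "\<not> s" "k"
      | (backward) "x = \<beta>" "y = \<alpha>" "s" "\<not> k"
      by (auto simp: arc_iff)
    then show ?case
    proof cases
      case old
      show ?thesis
      proof (cases "passable ?A C x h s")
        case True
        with old have "((x, h), (y, k)) \<in> ?M" by auto
        with prefix have "((\<gamma>, False), (y, k)) \<in> ?M\<^sup>*" by (rule rtrancl.rtrancl_into_rtrancl)
        with step.prems show ?thesis by (intro IH)
      next
        case False
        \<comment> \<open>The collider \<open>x\<close> reaches \<open>C\<close> only through the
          new edge. The rest, restarted at \<open>x\<close>, is extended back to \<alpha>; the
          prefix is extended down to \<alpha> and by (p2) to \<beta>; \<open>via\<close> joins the
          two.\<close>
        with s(2) have h: "h" and x: "x \<notin> ?A" "x \<in> An H C"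
          by (auto simp: passable_def split: if_splits)
        then have \<beta>: "\<beta> \<in> ?A" and path: "(x, \<alpha>) \<in> {(x, y). Directed x y \<in> edges G}\<^sup>*"
          using An_insert_Directed[OF H] by auto
        note path = directed_path_moves[OF path x(1)]
        have "x \<notin> C" "\<alpha> \<notin> C" using x(1) path(1) subset_An[of C G] by auto
        have "((x, False), (y, k)) \<in> ?M" using old \<open>x \<notin> C\<close> by (auto simp: passable_def)
        then have "((x, False), (y, k)) \<in> ?M\<^sup>*" by (rule r_into_rtrancl)
        then have "connected_given G C x \<delta>"
          using \<open>x \<notin> C\<close> arc_verts[OF G old] by (intro IH) blast+
        then have "connected_given G C \<alpha> \<delta>"
          using path(3) \<open>\<alpha> \<notin> C\<close> unfolding connected_given_def by (meson rtrancl_trans)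
        moreover have "connected_given G C \<gamma> \<alpha>"
          using rtrancl_trans[of _ _ ?M, OF _ path(2)] prefix h step.prems(2)
          by (simp add: connected_given_def)
        then have "connected_given G C \<gamma> \<beta>"
          using \<open>\<alpha> \<notin> C\<close> step.prems(1) by (intro p2)
        ultimately show ?thesis
          using via[of \<gamma> True] \<open>\<alpha> \<notin> C\<close> \<beta> step.prems by (simp add: passable_def connected_given_def)
      qed
    next
      case forward
      with s(2) have "\<alpha> \<notin> C" by (simp add: passable_def)
      \<comment> \<open>A prefix entering \<alpha> with a head is carried on by (p2), one entering
        with a tail by the walk from (p1).\<close>
      have "connected_given G C \<gamma> \<beta>"
      proof (cases h)
        case True
        with prefix forward step.prems(2) have "connected_given G C \<gamma> \<alpha>"
          by (simp add: connected_given_def)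
        with \<open>\<alpha> \<notin> C\<close> step.prems(1) show ?thesis by (intro p2)
      next
        case False
        with prefix forward step.prems(2) p1[OF \<open>\<alpha> \<notin> C\<close>] show ?thesis
          by (intro connected_given_extend[of \<gamma> \<alpha> False]) auto
      qed
      with IH[of \<gamma>] forward step.prems show ?thesis by (simp add: connected_given_def)
    next
      case backward
      \<comment> \<open>The flag after \<beta> \<leftarrow> \<alpha> is \<open>False\<close>, so the
        run does not end there, and its next move leaves \<alpha> as a noncollider.\<close>
      have "\<alpha> \<notin> C"
      proof (cases "q = (\<delta>, True)")
        case True
        with q backward show ?thesis by simp
      next
        case False
        with step(2) obtain r where "(q, r) \<in> moves H (An H C) C" by (metis converse_rtranclE)
        with q backward show ?thesis by (cases r) (auto simp: passable_def)
      qed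
      with IH[of \<alpha>] V backward have "connected_given G C \<alpha> \<delta>" by simp
      moreover have "passable ?A C \<beta> h True"
        using s(2) backward An_insert_Directed[OF H, of \<beta> C] by (auto simp: passable_def)
      ultimately show ?thesis
        using via[of \<gamma> h] \<open>\<alpha> \<notin> C\<close> prefix backward step.prems by simp
    qed
  qed
  with conn \<gamma> show ?thesis by (auto simp: connected_given_def)
qed

section \<open>From single edges to the whole potential graph\<close>

lemma indep_model_antimono:
  assumes "is_dmg G" "is_dmg H" "verts G = verts H" "edges G \<subseteq> edges H"
  shows "indep_model H \<subseteq> indep_model G"
proof (rule subrelI)
  fix A p assume A: "(A, p) \<in> indep_model H"
  obtain B C where p: "p = (B, C)" by (cases p)
  show "(A, p) \<in> indep_model G"
    using A connected_given_mono[OF assms(4)]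
    unfolding p in_indep_model_iff[OF assms(1)] in_indep_model_iff[OF assms(2)] assms(3) by blast
qed

lemma indep_model_insert_edge:
  assumes G: "is_dmg G" and H: "is_dmg H" "verts H = verts G" "edges H = insert e (edges G)"
    and e: "e \<in> edges (potential_graph (verts G) (indep_model G))"
  shows "indep_model H = indep_model G"
proof (rule indep_model_eqI[OF H(1) G H(2)])
  fix C a b
  assume *: "C \<subseteq> verts H" "a \<in> verts H" "b \<in> verts H"
  show "connected_given H C a b \<longleftrightarrow> connected_given G C a b"
  proof
    assume conn: "connected_given H C a b"
    from e consider \<alpha> \<beta> where "e = Directed \<alpha> \<beta>" "\<alpha> \<in> verts G" "\<beta> \<in> verts G"
        "potential_parent (verts G) (indep_model G) \<alpha> \<beta>"
      | \<alpha> \<beta> where "e = Bidirected (Upair \<alpha> \<beta>)" "\<alpha> \<in> verts G" "\<beta> \<in> verts G"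
        "potential_siblings (verts G) (indep_model G) \<alpha> \<beta>"
      by (auto simp: potential_graph_def)
    then show "connected_given G C a b"
    proof cases
      case 1
      with connected_given_insert_parent[OF G] conn * H show ?thesis by metis
    next
      case 2
      with connected_given_insert_siblings[OF G] conn * H show ?thesis by metis
    qed
  next
    show "connected_given G C a b \<Longrightarrow> connected_given H C a b"
      by (rule connected_given_mono) (auto simp: H)
  qed
qed

lemma potential_graph_wf:
  assumes "is_dmg G" "N = potential_graph (verts G) (indep_model G)"
  shows "is_dmg N" "verts N = verts G"
proof -
  have "finite (verts G)" using assms(1) by (simp add: is_dmg_def)
  then show "is_dmg N" unfolding assms(2) by (rule is_dmg_potential_graph)
  show "verts N = verts G" unfolding assms(2) by (simp add: potential_graph_def)
qed

text \<open>Induction on the number of missing edges. Adding one keeps the model, and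
  \<open>N\<close> is determined by the nodes and the model, so it remains the target.\<close>

lemma indep_model_potential_graph:
  assumes "is_dmg G" "N = potential_graph (verts G) (indep_model G)"
  shows "indep_model N = indep_model G"
  using assms
proof (induction "card (edges N - edges G)" arbitrary: G)
  case 0
  note N = potential_graph_wf[OF 0(2,3)]
  have "edges N = edges G"
    using 0(1) finite_edges[OF N(1)] edges_subset_potential_graph[OF 0(2)] unfolding 0(3)
    by (metis Diff_eq_empty_iff card_0_eq finite_Diff subset_antisym)
  with N(2) have "N = G" by (intro dmg.equality) simp_all
  then show ?case by simp
next
  case (Suc n)
  then have "edges N - edges G \<noteq> {}" by (metis card.empty nat.distinct(1))
  then obtain e where e: "e \<in> edges N" "e \<notin> edges G" by blast
  define H where "H = G\<lparr>edges := insert e (edges G)\<rparr>"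
  note N = potential_graph_wf[OF Suc.prems]
  then have H: "is_dmg H" "verts H = verts G" "edges H = insert e (edges G)"
    using e Suc.prems(1) by (auto simp: H_def is_dmg_def)
  have I: "indep_model H = indep_model G"
    by (rule indep_model_insert_edge[OF Suc.prems(1) H e(1)[unfolded Suc.prems(2)]])
  have "edges N - edges H = edges N - edges G - {e}"
    using H(3) by auto
  then have "n = card (edges N - edges H)"
    using Suc.hyps(2) e by simp
  moreover have "N = potential_graph (verts H) (indep_model H)"
    unfolding I H(2) by (rule Suc.prems(2))
  ultimately have "indep_model N = indep_model H" using Suc.hyps(1) H(1) by blast
  with I show ?case by simp
qed

theorem theorem5p9:
  fixes G N :: "'a dmg"
  assumes "is_dmg G"
    and "N = potential_graph (verts G) (indep_model G)"
  shows "N \<in> markov_class G \<and>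
    (\<forall>H\<in>markov_class G. supergraph N H) \<and>
    (\<forall>(m::nat) (Gs :: nat \<Rightarrow> 'a dmg).
        (\<forall>i\<le>m. is_dmg (Gs i) \<and> verts (Gs i) = verts G) \<longrightarrow>
        Gs 0 = G \<longrightarrow> Gs m = N \<longrightarrow>
        (\<forall>i<m. edges (Gs i) \<subseteq> edges (Gs (Suc i))) \<longrightarrow>
        (\<forall>i<m. markov_equivalent (Gs i) N))"
proof (intro conjI ballI allI impI)
  note N = potential_graph_wf[OF assms]
  have I: "indep_model N = indep_model G"
    using indep_model_potential_graph[OF assms] .
  show "N \<in> markov_class G"
    using N I by (simp add: markov_class_def markov_equivalent_def)
  \<comment> \<open>Since \<open>H\<close> has the nodes and the model of \<open>G\<close>,
    \<open>N\<close> is the potential graph of \<open>H\<close> as well.\<close>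
  show "supergraph N H" if "H \<in> markov_class G" for H
    using that edges_subset_potential_graph[of H] N(2) assms(2)
    by (auto simp: markov_class_def markov_equivalent_def supergraph_def)
  fix m i :: nat and Gs :: "nat \<Rightarrow> 'a dmg"
  assume Gs: "\<forall>i\<le>m. is_dmg (Gs i) \<and> verts (Gs i) = verts G" "Gs 0 = G" "Gs m = N"
    and chain: "\<forall>i<m. edges (Gs i) \<subseteq> edges (Gs (Suc i))" and i: "i < m"
  have up: "edges (Gs j) \<subseteq> edges (Gs k)" if "j \<le> k" "k \<le> m" for j k
    using that by (induction k rule: dec_induct) (use chain in \<open>auto simp: Suc_le_eq\<close>)
  have Gi: "is_dmg (Gs i)" "verts (Gs i) = verts G" using Gs(1) i by auto
  \<comment> \<open>Models shrink as edges are added, so that of \<open>Gs i\<close> lies between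
    those of \<open>N\<close> and \<open>G\<close>, which coincide.\<close>
  have "indep_model (Gs i) \<subseteq> indep_model G"
    using indep_model_antimono[OF assms(1) Gi(1)] up[of 0 i] i Gs(2) Gi by simp
  moreover have "indep_model N \<subseteq> indep_model (Gs i)"
    using indep_model_antimono[OF Gi(1) N(1)] up[of i m] i Gs(3) Gi N(2) by simp
  ultimately show "markov_equivalent (Gs i) N"
    using I Gi(2) N(2) by (simp add: markov_equivalent_def)
qed

end
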